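(* Let $A=\{a_1,a_2\}$ and $E=\{e_1,e_2\}$ be two alphabets. Then, as formal power series in $z$, $$\sum_{n=0}^{\infty} S_n(A)\,S_{2n+2}(E)\,z^n=\frac{(e_1+e_2)^2-e_1e_2-e_1^2e_2^2(a_1+a_2)z-a_1a_2e_1^3e_2^3z^2}{\left(\sum_{n=0}^{\infty}S_n(-A)e_1^{2n}z^n\right)\left(\sum_{n=0}^{\infty}S_n(-A)e_2^{2n}z^n\right)}.$$
   Context: Here $a_1,a_2,e_1,e_2$ are commuting variables (an alphabet is a set of variables), and identities are between formal power series in $z$ with coefficients in $\mathbb{Z}[a_1,a_2,e_1,e_2]$; the denominator has constant term $1$, so it is invertible. For an alphabet $X=\{x_1,x_2\}$, $S_n(X)$ is defined by $\sum_{n\ge 0}S_n(X)z^n=\frac{1}{(1-x_1z)(1-x_2z)}$, equivalently $S_n(X)=\frac{x_1^{n+1}-x_2^{n+1}}{x_1-x_2}$ for $n\ge 0$, and $S_n(X)=0$ for $n<0$. The quantities $S_n(-A)$ are defined by $\sum_{n\ge 0}S_n(-A)z^n=(1-a_1z)(1-a_2z)$. *)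

theory Defs
  imports
    "HOL-Library.Poly_Mapping"
    "HOL-Computational_Algebra.Formal_Power_Series"
begin

datatype letter = Letter_a1 | Letter_a2 | Letter_e1 | Letter_e2

text \<open>
  The polynomial ring \<open>\<int>[a\<^sub>1, a\<^sub>2, e\<^sub>1, e\<^sub>2]\<close>: a monomial is an exponent vector \<open>letter \<Rightarrow>\<^sub>0 nat\<close>.
\<close>

type_synonym zpoly = "(letter \<Rightarrow>\<^sub>0 nat) \<Rightarrow>\<^sub>0 int"

definition var :: "letter \<Rightarrow> zpoly" where
  "var x = Poly_Mapping.single (Poly_Mapping.single x 1) 1"

abbreviation a1 :: zpoly where "a1 \<equiv> var Letter_a1"
abbreviation a2 :: zpoly where "a2 \<equiv> var Letter_a2"
abbreviation e1 :: zpoly where "e1 \<equiv> var Letter_e1"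
abbreviation e2 :: zpoly where "e2 \<equiv> var Letter_e2"

text \<open>
  An alphabet is a finite set of variables, which are pairwise distinct elements of the ring.
\<close>

lemma var_eq_iff: "var x = var y \<longleftrightarrow> x = y"
proof
  assume "var x = var y"
  hence "Poly_Mapping.lookup (var x) (Poly_Mapping.single x 1) =
         Poly_Mapping.lookup (var y) (Poly_Mapping.single x 1)" by simp
  hence "Poly_Mapping.single y (1::nat) = Poly_Mapping.single x 1"
    by (simp add: var_def lookup_single when_def split: if_splits)
  hence "Poly_Mapping.lookup (Poly_Mapping.single y (1::nat)) x =
         Poly_Mapping.lookup (Poly_Mapping.single x 1) x" by simp
  thus "x = y" by (simp add: lookup_single when_def split: if_splits)
qed simp

text \<open>
  Division of power series over a field is not available here, as the coefficients only
  form a commutative ring. For \<open>g\<close> with constant term 1, \<open>fps_right_inverse g 1\<close> is the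
  inverse of \<open>g\<close>.
\<close>

lemma mult_fps_right_inverse_1:
  fixes g :: "zpoly fps"
  assumes "fps_nth g 0 = 1"
  shows "g * fps_right_inverse g 1 = 1"
  by (rule fps_right_inverse) (simp add: assms)

definition S_neg_series :: "zpoly set \<Rightarrow> zpoly fps" where
  "S_neg_series X = (\<Prod>x\<in>X. 1 - fps_const x * fps_X)"

definition S :: "int \<Rightarrow> zpoly set \<Rightarrow> zpoly" where
  "S n X = (if n < 0 then 0 else fps_nth (fps_right_inverse (S_neg_series X) 1) (nat n))"

text \<open>\<open>S_neg n X\<close> is \<open>S\<^sub>n(-X)\<close>, where \<open>-X\<close> is the formal negative of the alphabet \<open>X\<close>.\<close>

definition S_neg :: "nat \<Rightarrow> zpoly set \<Rightarrow> zpoly" where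
  "S_neg n X = fps_nth (S_neg_series X) n"

end

theory Submission
  imports Defs
begin

text \<open>
  Both \<open>S\<^sub>n(A)\<close> and \<open>S\<^sub>2\<^sub>n\<^sub>+\<^sub>2(E)\<close> satisfy linear recurrences of order two in \<open>n\<close>, with characteristic
  roots \<open>a\<^sub>1, a\<^sub>2\<close> and \<open>e\<^sub>1\<^sup>2, e\<^sub>2\<^sup>2\<close>. Their product therefore satisfies the recurrence of order four
  with characteristic roots \<open>a\<^sub>i e\<^sub>j\<^sup>2\<close>, so multiplying the generating function by the
  denominator leaves a polynomial determined by the first four coefficients. Working with
  recurrences avoids dividing by \<open>a\<^sub>1 - a\<^sub>2\<close> or \<open>e\<^sub>1 - e\<^sub>2\<close>.
\<close>

lemma fps_linear_mult_nth_Suc: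
  fixes f :: "'a::comm_ring_1 fps"
  shows "fps_nth ((1 - fps_const c * fps_X) * f) (Suc n) = fps_nth f (Suc n) - c * fps_nth f n"
  by (simp add: left_diff_distrib mult.assoc)

lemma fps_linear_mult_nth_0:
  fixes f :: "'a::comm_ring_1 fps"
  shows "fps_nth ((1 - fps_const c * fps_X) * f) 0 = fps_nth f 0"
  by (simp add: left_diff_distrib mult.assoc)

lemmas fps_linear_mult_nth = fps_linear_mult_nth_0 fps_linear_mult_nth_Suc

lemma quadratic_inverse_nth:
  fixes f :: "'a::comm_ring_1 fps"
  assumes "(1 - fps_const x * fps_X) * (1 - fps_const y * fps_X) * f = 1"
  shows "fps_nth f 0 = 1"
    and "fps_nth f (Suc 0) = x + y"
    and "fps_nth f (Suc (Suc n)) = (x + y) * fps_nth f (Suc n) - x * y * fps_nth f n"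
proof -
  let ?h = "(1 - fps_const x * fps_X) * ((1 - fps_const y * fps_X) * f)"
  have h: "?h = 1"
    using assms by (simp only: mult.assoc)
  show f0: "fps_nth f 0 = 1"
    using arg_cong[OF h, of "\<lambda>g. fps_nth g 0"] by (simp only: fps_linear_mult_nth) simp
  show "fps_nth f (Suc 0) = x + y"
    using arg_cong[OF h, of "\<lambda>g. fps_nth g (Suc 0)"] f0
    by (simp only: fps_linear_mult_nth) (simp add: algebra_simps)
  show "fps_nth f (Suc (Suc n)) = (x + y) * fps_nth f (Suc n) - x * y * fps_nth f n"
    using arg_cong[OF h, of "\<lambda>g. fps_nth g (Suc (Suc n))"]
    by (simp only: fps_linear_mult_nth) (simp add: algebra_simps)
qed

lemma quadratic_rescale:
  fixes x y c :: "'a::comm_ring_1"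
  shows "Abs_fps (\<lambda>n. fps_nth ((1 - fps_const x * fps_X) * (1 - fps_const y * fps_X)) n * c ^ n) =
    (1 - fps_const (x * c) * fps_X) * (1 - fps_const (y * c) * fps_X)"
proof (rule fps_ext)
  fix n
  consider "n = 0" | "n = Suc 0" | "n = Suc (Suc 0)" | m where "n = Suc (Suc (Suc m))"
    by (metis nat.exhaust)
  then show "fps_nth (Abs_fps (\<lambda>n. fps_nth ((1 - fps_const x * fps_X) * (1 - fps_const y * fps_X)) n * c ^ n)) n =
    fps_nth ((1 - fps_const (x * c) * fps_X) * (1 - fps_const (y * c) * fps_X)) n"
    by cases (simp_all only: fps_linear_mult_nth fps_nth_Abs_fps, simp_all add: algebra_simps)
qed

lemma product_of_recurrences_fps:
  fixes u v :: "nat \<Rightarrow> 'a::comm_ring_1"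
  assumes u: "u 0 = 1" "u (Suc 0) = x1 + x2"
      "\<And>n. u (Suc (Suc n)) = (x1 + x2) * u (Suc n) - x1 * x2 * u n"
    and v: "\<And>n. v (Suc (Suc n)) = (y1 + y2) * v (Suc n) - y1 * y2 * v n"
  shows "(1 - fps_const (x1 * y1) * fps_X) * ((1 - fps_const (x2 * y1) * fps_X) *
      ((1 - fps_const (x1 * y2) * fps_X) * ((1 - fps_const (x2 * y2) * fps_X) *
        Abs_fps (\<lambda>n. u n * v n)))) =
    fps_const (v 0) + fps_const ((x1 + x2) * (v (Suc 0) - (y1 + y2) * v 0)) * fps_X
      - fps_const (x1 * x2 * ((y1 + y2) * v (Suc 0) - ((y1 + y2)\<^sup>2 - y1 * y2) * v 0)) * fps_X\<^sup>2"
    (is "?lhs = ?rhs")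
proof (rule fps_ext)
  fix n
  consider "n = 0" | "n = Suc 0" | "n = Suc (Suc 0)" | "n = Suc (Suc (Suc 0))"
    | m where "n = Suc (Suc (Suc (Suc m)))"
    by (metis nat.exhaust)
  then show "fps_nth ?lhs n = fps_nth ?rhs n"
    by cases (simp_all only: fps_linear_mult_nth fps_nth_Abs_fps u v,
        simp_all add: fps_X_power_iff, (simp_all add: algebra_simps power2_eq_square)?)
qed

lemma S_neg_series_pair:
  "x \<noteq> y \<Longrightarrow> S_neg_series {x, y} = (1 - fps_const x * fps_X) * (1 - fps_const y * fps_X)"
  by (simp add: S_neg_series_def)

lemma S_pair:
  assumes "x \<noteq> y"
  shows "S 0 {x, y} = 1" and "S 1 {x, y} = x + y"
    and "S (int n + 2) {x, y} = (x + y) * S (int n + 1) {x, y} - x * y * S (int n) {x, y}"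
proof -
  have "S_neg_series {x, y} * fps_right_inverse (S_neg_series {x, y}) 1 = 1"
    by (rule mult_fps_right_inverse_1) (simp add: S_neg_series_pair[OF assms])
  note rec = quadratic_inverse_nth[OF this[unfolded S_neg_series_pair[OF assms]]]
  have nat: "nat (int n + 2) = Suc (Suc n)" "nat (int n + 1) = Suc n"
    by simp_all
  show "S 0 {x, y} = 1" "S 1 {x, y} = x + y"
    using rec(1,2) by (simp_all add: S_def S_neg_series_pair[OF assms])
  show "S (int n + 2) {x, y} = (x + y) * S (int n + 1) {x, y} - x * y * S (int n) {x, y}"
    using rec(3)[of n] by (simp add: S_def S_neg_series_pair[OF assms] nat)
qed

lemma S_pair_even_step:
  assumes "x \<noteq> y"
  shows "S (int n + 4) {x, y} =
    (x\<^sup>2 + y\<^sup>2) * S (int n + 2) {x, y} - x\<^sup>2 * y\<^sup>2 * S (int n) {x, y}"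
proof -
  let ?s = "\<lambda>k. S (int n + k) {x, y}"
  have s1: "(x + y) * ?s 1 = ?s 2 + x * y * ?s 0"
    using S_pair(3)[OF assms, of n] by simp
  have s3: "?s 3 = (x + y) * ?s 2 - x * y * ?s 1"
    using S_pair(3)[OF assms, of "Suc n"] by (simp add: add.commute add.left_commute)
  have "?s 4 = (x + y) * ?s 3 - x * y * ?s 2"
    using S_pair(3)[OF assms, of "Suc (Suc n)"] by (simp add: add.commute add.left_commute)
  also have "\<dots> = (x + y) * ((x + y) * ?s 2) - x * y * ((x + y) * ?s 1) - x * y * ?s 2"
    unfolding s3 by (simp add: algebra_simps)
  also have "\<dots> = (x\<^sup>2 + y\<^sup>2) * ?s 2 - x\<^sup>2 * y\<^sup>2 * ?s 0"
    unfolding s1 by (simp add: algebra_simps power2_eq_square)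
  finally show ?thesis
    by simp
qed

theorem theorem4:
  fixes A E :: "zpoly set" and z :: "zpoly fps"
  defines "A \<equiv> {a1, a2}" and "E \<equiv> {e1, e2}" and "z \<equiv> fps_X"
  shows "Abs_fps (\<lambda>n. S (int n) A * S (2 * int n + 2) E) =
     (fps_const ((e1 + e2)^2 - e1 * e2)
        - fps_const (e1^2 * e2^2 * (a1 + a2)) * z
        - fps_const (a1 * a2 * e1^3 * e2^3) * z^2)
     * fps_right_inverse
         (Abs_fps (\<lambda>n. S_neg n A * e1^(2 * n)) * Abs_fps (\<lambda>n. S_neg n A * e2^(2 * n))) 1"
    (is "?F = ?N * fps_right_inverse ?D 1")
proof -
  have neq: "a1 \<noteq> a2" "e1 \<noteq> e2"
    by (simp_all add: var_eq_iff)
  define u where "u n = S (int n) A" for n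
  define v where "v n = S (2 * int n + 2) E" for n
  have u: "u 0 = 1" "u (Suc 0) = a1 + a2"
    "u (Suc (Suc n)) = (a1 + a2) * u (Suc n) - a1 * a2 * u n" for n
    using S_pair(1,2)[OF neq(1)] S_pair(3)[OF neq(1), of n]
    by (simp_all add: u_def A_def add.commute)
  have v: "v (Suc (Suc n)) = (e1\<^sup>2 + e2\<^sup>2) * v (Suc n) - e1\<^sup>2 * e2\<^sup>2 * v n" for n
    using S_pair_even_step[OF neq(2), of "2 * n + 2"]
    by (simp add: v_def E_def algebra_simps)
  have S2: "S 2 E = (e1 + e2)\<^sup>2 - e1 * e2"
    using S_pair(1,2)[OF neq(2)] S_pair(3)[OF neq(2), of 0]
    by (simp add: E_def power2_eq_square)
  have v0: "v 0 = (e1 + e2)\<^sup>2 - e1 * e2"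
    using S2 by (simp add: v_def)
  have v1: "v (Suc 0) = (e1\<^sup>2 + e2\<^sup>2) * v 0 - e1\<^sup>2 * e2\<^sup>2"
    using S_pair_even_step[OF neq(2), of 0] S_pair(1)[OF neq(2)]
    by (simp add: v_def E_def)
  have D: "?D = ((1 - fps_const (a1 * e1\<^sup>2) * fps_X) * (1 - fps_const (a2 * e1\<^sup>2) * fps_X)) *
      ((1 - fps_const (a1 * e2\<^sup>2) * fps_X) * (1 - fps_const (a2 * e2\<^sup>2) * fps_X))"
    unfolding S_neg_def A_def S_neg_series_pair[OF neq(1)] power_mult quadratic_rescale ..
  have coeff1: "(a1 + a2) * (v (Suc 0) - (e1\<^sup>2 + e2\<^sup>2) * v 0) = - (e1\<^sup>2 * e2\<^sup>2 * (a1 + a2))"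
    by (simp add: v1 algebra_simps)
  have coeff2: "a1 * a2 * ((e1\<^sup>2 + e2\<^sup>2) * v (Suc 0) - ((e1\<^sup>2 + e2\<^sup>2)\<^sup>2 - e1\<^sup>2 * e2\<^sup>2) * v 0) =
      a1 * a2 * e1^3 * e2^3"
    by (simp add: v1 v0 algebra_simps power2_eq_square power3_eq_cube)
  have "?D * Abs_fps (\<lambda>n. u n * v n) = fps_const (v 0)
      + fps_const (- (e1\<^sup>2 * e2\<^sup>2 * (a1 + a2))) * fps_X
      - fps_const (a1 * a2 * e1^3 * e2^3) * fps_X\<^sup>2"
    using product_of_recurrences_fps[of u a1 a2 v "e1\<^sup>2" "e2\<^sup>2", OF u v]
    by (simp only: D coeff1 coeff2 mult.assoc[where 'a = "zpoly fps"])
  also have "\<dots> = ?N"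
    by (simp only: v0 z_def fps_const_neg[symmetric] mult_minus_left add_uminus_conv_diff)
  finally have DF: "?D * ?F = ?N"
    by (simp only: u_def v_def)
  have "?D * fps_right_inverse ?D 1 = 1"
    by (rule mult_fps_right_inverse_1) (simp add: D)
  then have "?F = ?F * (?D * fps_right_inverse ?D 1)"
    by (simp only: mult_1_right)
  also have "\<dots> = (?D * ?F) * fps_right_inverse ?D 1"
    by (simp only: mult.assoc mult.left_commute)
  also have "\<dots> = ?N * fps_right_inverse ?D 1"
    by (simp only: DF)
  finally show ?thesis .
qed

end
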